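(* Let $G\cong\bigoplus_{i=1}^r\mathbb{Z}_{N_i}$ be a finite abelian group with invariant factors $N_1\mid N_2\mid\cdots\mid N_r$ ($r\ge 1$, each $N_i>1$), and let $k$ be the number of indices $i$ such that $N_i$ is odd or a power of $2$. Let $f:G\to\mathbb{Q}$, and suppose that $S(f)$ contains the $r$ elements $x_i=(1,\dots,1,e_1,1,\dots,1)\in\widehat G\cong\prod_{j=1}^r\widehat{\mathbb{Z}}_{N_j}$, $i=1,\dots,r$, where $e_1$ is in the $\widehat{\mathbb{Z}}_{N_i}$ component and all other components are trivial characters. Then $\{\rho_n: n=1,\dots,3(3r-k)\}$ is a complete set of translation invariants for $f$, and so determines $f$ up to a shift; that is, if $g:G\to\mathbb{Q}$ satisfies $\rho_n(f)=\rho_n(g)$ for all $n=1,\dots,3(3r-k)$, then there exists $a\in G$ such that $f(x)=g(x+a)$ for all $x\in G$.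
   Context: $\mathbb{Z}_N=\mathbb{Z}/N\mathbb{Z}$. $\widehat G$ is the dual group of characters of $G$, written multiplicatively. For $f:G\to\mathbb{C}$ the $n$th-order autocorrelation is $\rho_n(f)(t_1,\dots,t_{n-1})=\sum_{x\in G}f(x)f(x+t_1)\cdots f(x+t_{n-1})$ for $t_i\in G$ (for $n=1$ it is the constant $\sum_{x\in G}f(x)$). The Fourier transform is $\hat f(\chi)=\sum_{x\in G}f(x)\overline{\chi(x)}$ for $\chi\in\widehat G$, and the support of $f$ is defined on the Fourier side: $S(f)=\{\chi\in\widehat G:\hat f(\chi)\neq0\}$. In $\widehat{\mathbb{Z}}_N$, $e_1$ denotes the character $x\mapsto e^{2\pi i x/N}$. *)

theory Defs
  imports Complex_Main "HOL-Algebra.Product_Groups"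
begin

definition circle_group :: "complex monoid" where
  "circle_group = \<lparr>carrier = {z. norm z = 1}, monoid.mult = (*), one = 1\<rparr>"

text \<open>Functions on a group are extensional wherever they have to be compared for equality:
  characters, and the autocorrelations viewed as functions of the shifts.\<close>

definition dual_group :: "('a, 'b) monoid_scheme \<Rightarrow> ('a \<Rightarrow> complex) monoid" where
  "dual_group G =
     \<lparr>carrier = hom G circle_group \<inter> extensional (carrier G),
      monoid.mult = (\<lambda>\<chi> \<psi>. \<lambda>x\<in>carrier G. \<chi> x * \<psi> x),
      one = (\<lambda>x\<in>carrier G. 1)\<rparr>"

text \<open>The shifts \<open>t\<^sub>1, \<dots>, t\<^sub>n\<^sub>-\<^sub>1\<close> are given by a function on \<open>{1..<n}\<close>.\<close>

definition autocorrelation ::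
    "('a, 'b) monoid_scheme \<Rightarrow> nat \<Rightarrow> ('a \<Rightarrow> complex) \<Rightarrow> (nat \<Rightarrow> 'a) \<Rightarrow> complex" where
  "autocorrelation G n f =
     (\<lambda>t\<in>(\<Pi>\<^sub>E i\<in>{1..<n}. carrier G).
        \<Sum>x\<in>carrier G. f x * (\<Prod>i\<in>{1..<n}. f (x \<otimes>\<^bsub>G\<^esub> t i)))"

definition fourier_transform ::
    "('a, 'b) monoid_scheme \<Rightarrow> ('a \<Rightarrow> complex) \<Rightarrow> ('a \<Rightarrow> complex) \<Rightarrow> complex" where
  "fourier_transform G f \<chi> = (\<Sum>x\<in>carrier G. f x * cnj (\<chi> x))"

definition fourier_support ::
    "('a, 'b) monoid_scheme \<Rightarrow> ('a \<Rightarrow> complex) \<Rightarrow> ('a \<Rightarrow> complex) set" where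
  "fourier_support G f = {\<chi> \<in> carrier (dual_group G). fourier_transform G f \<chi> \<noteq> 0}"

definition e1 :: "nat \<Rightarrow> int \<Rightarrow> complex" where
  "e1 N = (\<lambda>x\<in>carrier (integer_mod_group N). exp (2 * of_real pi * \<i> * of_int x / of_nat N))"

text \<open>Given an isomorphism \<open>\<phi>\<close> of \<open>G\<close> with a direct sum indexed by \<open>I\<close>, the character of
  \<open>G\<close> corresponding to a tuple \<open>\<chi>\<close> of characters of the summands.\<close>

definition character_of_tuple ::
    "('a, 'b) monoid_scheme \<Rightarrow> ('a \<Rightarrow> 'i \<Rightarrow> 'c) \<Rightarrow> 'i set \<Rightarrow> ('i \<Rightarrow> 'c \<Rightarrow> complex) \<Rightarrow>
      'a \<Rightarrow> complex" where
  "character_of_tuple G \<phi> I \<chi> = (\<lambda>x\<in>carrier G. \<Prod>j\<in>I. \<chi> j (\<phi> x j))"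

definition basic_character ::
    "('a, 'b) monoid_scheme \<Rightarrow> ('a \<Rightarrow> nat \<Rightarrow> int) \<Rightarrow> nat \<Rightarrow> (nat \<Rightarrow> nat) \<Rightarrow> nat \<Rightarrow>
      'a \<Rightarrow> complex" where
  "basic_character G \<phi> r N i =
     character_of_tuple G \<phi> {1..r}
       (\<lambda>j. if j = i then e1 (N j) else \<one>\<^bsub>dual_group (integer_mod_group (N j))\<^esub>)"

end

theory Submission
  imports Defs "HOL-Library.Function_Algebras" "HOL-Number_Theory.Number_Theory"
    "Jordan_Normal_Form.Char_Poly"
begin

text \<open>On the Fourier side, equality of the autocorrelations of order \<open>n\<close> says that \<open>f\<close> and \<open>g\<close>
  have the same products of Fourier coefficients along any \<open>n\<close> characters with product \<open>1\<close>. Since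
  \<open>f\<close> is rational, Galois conjugation puts all powers \<open>x\<^sub>i\<^sup>u\<close> with \<open>u\<close> a unit modulo \<open>N\<^sub>i\<close> into the
  support of \<open>f\<close>. Every integer is a sum of at most two units modulo \<open>N\<^sub>i\<close> if \<open>N\<^sub>i\<close> is odd or a
  power of \<open>2\<close>, and of at most three otherwise, so every character is a product of at most
  \<open>s = 3r - k\<close> elements of the support. Orders up to \<open>3s\<close> then suffice to extend the ratio of the
  Fourier transforms of \<open>f\<close> and \<open>g\<close> from the support to a homomorphism on the whole dual group,
  i.e. to evaluation at some \<open>a\<close> in \<open>G\<close>, and \<open>f\<close> is the translate of \<open>g\<close> by \<open>a\<close>.\<close>

section \<open>Conjugation of vanishing rational sums of roots of unity\<close>

text \<open>The subring \<open>\<int>[w]\<close> generated by \<open>w\<close>, given inductively so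
  that facts about all its elements follow by rule induction.\<close>

inductive_set int_adjoin :: "'a::comm_ring_1 \<Rightarrow> 'a set" for w where
  of_int: "of_int c \<in> int_adjoin w"
| gen: "w \<in> int_adjoin w"
| add: "x \<in> int_adjoin w \<Longrightarrow> y \<in> int_adjoin w \<Longrightarrow> x + y \<in> int_adjoin w"
| mult: "x \<in> int_adjoin w \<Longrightarrow> y \<in> int_adjoin w \<Longrightarrow> x * y \<in> int_adjoin w"

lemma int_adjoin_0: "0 \<in> int_adjoin w"
  using int_adjoin.of_int[of 0 w] by simp

lemma int_adjoin_1: "1 \<in> int_adjoin w"
  using int_adjoin.of_int[of 1 w] by simp

lemma int_adjoin_power: "x \<in> int_adjoin w \<Longrightarrow> x ^ k \<in> int_adjoin w"
  by (induction k) (auto intro: int_adjoin.mult int_adjoin_1)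

lemma int_adjoin_sum: "(\<And>i. i \<in> X \<Longrightarrow> y i \<in> int_adjoin w) \<Longrightarrow> sum y X \<in> int_adjoin w"
  by (induction X rule: infinite_finite_induct) (auto intro: int_adjoin.add int_adjoin_0)

lemma int_adjoin_minus: "x \<in> int_adjoin w \<Longrightarrow> - x \<in> int_adjoin w"
  using int_adjoin.mult[OF int_adjoin.of_int[of "-1" w], of x] by simp

lemma int_adjoin_poly: "x \<in> int_adjoin w \<Longrightarrow> poly (map_poly of_int p) x \<in> int_adjoin w"
proof (induction p)
  case 0
  then show ?case by (simp add: int_adjoin_0)
next
  case (pCons a p)
  then show ?case
    by (simp add: of_int_hom.map_poly_pCons_hom int_adjoin.intros)
qed

lemma power_mod_root_of_unity:
  fixes w :: "'a::comm_ring_1"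
  assumes "w ^ n = 1"
  shows "w ^ (k mod n) = w ^ k"
proof -
  have "w ^ k = w ^ (n * (k div n) + k mod n)" by simp
  also have "\<dots> = w ^ (k mod n)" by (simp only: power_add power_mult assms) simp
  finally show ?thesis by simp
qed

lemma sum_powers_reduce:
  fixes w :: "'a::comm_ring_1"
  assumes "w ^ n = 1" "n > 0" "finite X"
  shows "(\<Sum>i\<in>X. of_int (c i) * w ^ e i) =
         (\<Sum>j<n. of_int (\<Sum>i | i \<in> X \<and> e i mod n = j. c i) * w ^ j)"
proof -
  have "(\<Sum>i\<in>X. of_int (c i) * w ^ e i) =
        (\<Sum>j<n. \<Sum>i | i \<in> X \<and> e i mod n = j. of_int (c i) * w ^ e i)"
    using assms by (intro sum.group[symmetric]) auto
  also have "\<dots> = (\<Sum>j<n. \<Sum>i | i \<in> X \<and> e i mod n = j. of_int (c i) * w ^ j)"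
    by (intro sum.cong refl) (auto simp: power_mod_root_of_unity[OF assms(1)])
  finally show ?thesis by (simp add: sum_distrib_right)
qed

text \<open>Constants, \<open>w\<close> itself and products are sums of powers of \<open>w\<close>
  with arbitrary exponents, which \<open>sum_powers_reduce\<close> brings below \<open>n\<close>.
  The powers only span; the coefficients need not be unique.\<close>

lemma int_adjoin_basis:
  fixes w :: "'a::comm_ring_1"
  assumes "w ^ n = 1" "n > 0" "x \<in> int_adjoin w"
  shows "\<exists>c. x = (\<Sum>j<n. of_int (c j) * w ^ j)"
  using assms(3)
proof induction
  case (of_int c)
  have "of_int c = (\<Sum>i\<in>{0::nat}. of_int c * w ^ i)" by simp
  also have "\<dots> = (\<Sum>j<n. of_int (\<Sum>i | i \<in> {0} \<and> i mod n = j. c) * w ^ j)"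
    using assms by (intro sum_powers_reduce) simp_all
  finally show ?case by - (rule exI)
next
  case gen
  have "w = (\<Sum>i\<in>{1::nat}. of_int 1 * w ^ i)" by simp
  also have "\<dots> = (\<Sum>j<n. of_int (\<Sum>i | i \<in> {1} \<and> i mod n = j. 1) * w ^ j)"
    using assms by (intro sum_powers_reduce) simp_all
  finally show ?case by - (rule exI)
next
  case (add x y)
  then obtain c d where "x = (\<Sum>j<n. of_int (c j) * w ^ j)" "y = (\<Sum>j<n. of_int (d j) * w ^ j)"
    by blast
  then have "x + y = (\<Sum>j<n. of_int (c j + d j) * w ^ j)"
    by (simp add: sum.distrib ring_distribs)
  then show ?case by - (rule exI)
next
  case (mult x y)
  then obtain c d where "x = (\<Sum>j<n. of_int (c j) * w ^ j)" "y = (\<Sum>j<n. of_int (d j) * w ^ j)"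
    by blast
  then have "x * y = (\<Sum>p\<in>{..<n} \<times> {..<n}.
      (of_int (c (fst p)) * w ^ fst p) * (of_int (d (snd p)) * w ^ snd p))"
    by (simp only: sum_product sum.cartesian_product split_def)
  also have "\<dots> = (\<Sum>p\<in>{..<n} \<times> {..<n}. of_int (c (fst p) * d (snd p)) * w ^ (fst p + snd p))"
    by (intro sum.cong refl) (simp only: of_int_mult power_add mult_ac)
  also have "\<dots> = (\<Sum>j<n. of_int (\<Sum>p | p \<in> {..<n} \<times> {..<n} \<and> (fst p + snd p) mod n = j.
      c (fst p) * d (snd p)) * w ^ j)"
    using assms by (intro sum_powers_reduce) simp_all
  finally show ?case by - (rule exI)
qed

text \<open>An element of \<open>\<int>[w]\<close> is an eigenvalue of the integer matrix of its multiplication map on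
  the generators \<open>1, w, \<dots>, w\<^sup>n\<^sup>-\<^sup>1\<close>.\<close>

lemma algebraic_int_int_adjoin:
  fixes w :: complex
  assumes "w ^ n = 1" "n > 0" "x \<in> int_adjoin w"
  shows "algebraic_int x"
proof -
  have "\<forall>i. \<exists>c. x * w ^ i = (\<Sum>j<n. of_int (c j) * w ^ j)"
    using assms by (intro allI int_adjoin_basis int_adjoin.mult int_adjoin_power int_adjoin.gen)
  then obtain M where M: "\<And>i. x * w ^ i = (\<Sum>j<n. of_int (M i j) * w ^ j)"
    by metis
  define A :: "int mat" where "A = mat n n (\<lambda>(i, j). M i j)"
  define v where "v = vec n (\<lambda>i. w ^ i)"
  have A: "A \<in> carrier_mat n n" by (simp add: A_def)
  have Ac: "map_mat complex_of_int A \<in> carrier_mat n n" using A by simp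
  have "map_mat complex_of_int A *\<^sub>v v = x \<cdot>\<^sub>v v"
    by (rule eq_vecI) (auto simp: A_def v_def M scalar_prod_def atLeast0LessThan intro!: sum.cong)
  moreover have "v \<noteq> 0\<^sub>v n"
  proof
    assume "v = 0\<^sub>v n"
    then have "v $ 0 = 0" using assms(2) by simp
    then show False using assms(2) by (simp add: v_def)
  qed
  ultimately have "eigenvalue (map_mat complex_of_int A) x"
    unfolding eigenvalue_def eigenvector_def using A
    by (intro exI[of _ v]) (simp add: v_def A_def)
  then have "poly (char_poly (map_mat complex_of_int A)) x = 0"
    using eigenvalue_root_char_poly[OF Ac] by simp
  then have "poly (map_poly of_int (char_poly A)) x = 0"
    by (simp add: of_int_hom.char_poly_hom[OF A])
  moreover have "lead_coeff (char_poly A) = 1"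
    using degree_monic_char_poly[OF A] by simp
  ultimately show ?thesis
    unfolding algebraic_int_altdef_ipoly by blast
qed

text \<open>Splitting off the constant coefficient \<open>a\<close> of an annihilating polynomial
  shows that \<open>x\<close> divides \<open>- a\<close> with cofactor in \<open>\<int>[w]\<close>.
  If \<open>a = 0\<close>, a factor \<open>x\<close> is cancelled first.\<close>

lemma int_adjoin_dvd_int:
  fixes w :: "'a::idom"
  assumes "p \<noteq> 0" "poly (map_poly of_int p) x = 0" "x \<in> int_adjoin w" "x \<noteq> 0"
  shows "\<exists>c y. c \<noteq> 0 \<and> y \<in> int_adjoin w \<and> x * y = of_int c"
  using assms(1,2)
proof (induction p)
  case 0
  then show ?case by simp
next
  case (pCons a p)
  have eq: "of_int a + x * poly (map_poly of_int p) x = 0"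
    using pCons.prems(2) by (simp add: of_int_hom.map_poly_pCons_hom)
  show ?case
  proof (cases "a = 0")
    case True
    then show ?thesis using pCons eq assms(4) by auto
  next
    case False
    have "x * poly (map_poly of_int p) x = of_int (- a)"
      using eq by (simp add: eq_neg_iff_add_eq_0 add.commute)
    then show ?thesis
      using False int_adjoin_poly[OF assms(3)] by (meson neg_equal_0_iff_equal)
  qed
qed

section \<open>Frobenius congruences modulo a prime\<close>

text \<open>All inner binomial coefficients are divisible by \<open>q\<close>, and the quotients are
  integers, so that the remainder stays in \<open>\<int>[w]\<close>.\<close>

lemma int_adjoin_add_power_prime:
  fixes x y w :: "'a::comm_ring_1"
  assumes "prime q" "x \<in> int_adjoin w" "y \<in> int_adjoin w"
  shows "\<exists>r\<in>int_adjoin w. (x + y) ^ q = x ^ q + y ^ q + of_nat q * r"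
proof -
  have q: "q > 0" using assms(1) prime_gt_0_nat by blast
  define t where "t k = of_nat ((q choose k) div q) * x ^ k * y ^ (q - k)" for k
  have dvd: "q dvd q choose k" if "k \<in> {1..<q}" for k
    using that assms(1) by (intro dvd_choose_prime) auto
  have "(x + y) ^ q = (\<Sum>k\<le>q. of_nat (q choose k) * x ^ k * y ^ (q - k))"
    by (rule binomial_ring)
  also have "{..q} = insert 0 (insert q {1..<q})" using q by auto
  also have "(\<Sum>k\<in>\<dots>. of_nat (q choose k) * x ^ k * y ^ (q - k)) =
      y ^ q + (x ^ q + (\<Sum>k\<in>{1..<q}. of_nat (q choose k) * x ^ k * y ^ (q - k)))"
    using q by simp
  also have "(\<Sum>k\<in>{1..<q}. of_nat (q choose k) * x ^ k * y ^ (q - k)) = of_nat q * (\<Sum>k\<in>{1..<q}. t k)"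
    unfolding sum_distrib_left t_def
  proof (intro sum.cong refl)
    fix k assume "k \<in> {1..<q}"
    then have "q choose k = q * ((q choose k) div q)" using dvd by simp
    then have "of_nat (q choose k) = of_nat q * (of_nat ((q choose k) div q) :: 'a)"
      by (metis of_nat_mult)
    then show "of_nat (q choose k) * x ^ k * y ^ (q - k) =
        of_nat q * (of_nat ((q choose k) div q) * x ^ k * y ^ (q - k))"
      by (simp only: mult.assoc)
  qed
  finally have "(x + y) ^ q = x ^ q + y ^ q + of_nat q * (\<Sum>k\<in>{1..<q}. t k)" by simp
  moreover have "t k \<in> int_adjoin w" for k
    unfolding t_def using assms(2,3) int_adjoin.of_int[of "int ((q choose k) div q)" w]
    by (intro int_adjoin.mult int_adjoin_power) auto
  ultimately show ?thesis using int_adjoin_sum[of "{1..<q}" t w] by blast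
qed

lemma int_adjoin_sum_power_prime:
  fixes w :: "'a::comm_ring_1"
  assumes "prime q" "finite X" "\<And>i. i \<in> X \<Longrightarrow> y i \<in> int_adjoin w"
  shows "\<exists>r\<in>int_adjoin w. sum y X ^ q = (\<Sum>i\<in>X. y i ^ q) + of_nat q * r"
  using assms(2,3)
proof (induction X)
  case empty
  then show ?case using zero_power[OF prime_gt_0_nat[OF assms(1)]] int_adjoin_0 by (auto intro!: bexI[of _ 0])
next
  case (insert i X)
  obtain r where r: "r \<in> int_adjoin w" "sum y X ^ q = (\<Sum>i\<in>X. y i ^ q) + of_nat q * r"
    using insert by auto
  obtain s where s: "s \<in> int_adjoin w"
      "(y i + sum y X) ^ q = y i ^ q + sum y X ^ q + of_nat q * s"
    using int_adjoin_add_power_prime[OF assms(1), of "y i" w "sum y X"] insert.prems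
      int_adjoin_sum[of X y w] by auto
  have "sum y (insert i X) ^ q = (\<Sum>i\<in>insert i X. y i ^ q) + of_nat q * (r + s)"
    using insert.hyps r(2) s(2) by (simp add: algebra_simps)
  then show ?case using r(1) s(1) int_adjoin.add by blast
qed

lemma fermat_int: "[a ^ q = a] (mod int q)" if "prime q"
proof (cases "int q dvd a")
  case True
  then have "int q dvd a ^ q"
    using that by (metis dvd_power prime_gt_0_nat dvd_trans)
  then show ?thesis using True by (simp add: cong_def)
next
  case False
  have q: "q > 0" using that prime_gt_0_nat by blast
  define b where "b = nat (a mod int q)"
  have b: "int b = a mod int q" using q by (simp add: b_def)
  then have ab: "[int b = a] (mod int q)" by (simp add: cong_def)
  have "\<not> q dvd b" using False b
    by (metis dvd_mod_iff dvd_refl int_dvd_int_iff)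
  then have "[b ^ (q - 1) = 1] (mod q)" using fermat_theorem that by blast
  then have "[b ^ (q - 1) * b = 1 * b] (mod q)" by (rule cong_scalar_right)
  then have "[b ^ q = b] (mod q)" using q by (simp flip: power_Suc2)
  then have "[int b ^ q = int b] (mod int q)" by (metis cong_int_iff of_nat_power)
  then show ?thesis using ab by (meson cong_pow cong_sym cong_trans)
qed

text \<open>Modulo a prime \<open>q\<close> the sum at \<open>z\<^sup>q\<close> is the \<open>q\<close>-th power of the sum at \<open>z\<close>. If the
  latter vanishes, the former is divisible by \<open>q\<close> in \<open>\<int>[w]\<close>; being one of finitely many
  numbers, each of which divides a nonzero integer if nonzero, it vanishes when \<open>q\<close> is large.\<close>

lemma vanishing_sum_power_large_prime:
  fixes w :: complex and a :: "'i \<Rightarrow> int" and e :: "'i \<Rightarrow> nat"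
  assumes w: "w ^ n = 1" "n > 0" and X: "finite X"
  defines "S \<equiv> \<lambda>z. \<Sum>i\<in>X. of_int (a i) * z ^ e i"
  shows "\<exists>B. \<forall>q j. prime q \<longrightarrow> q > B \<longrightarrow> S (w ^ j) = 0 \<longrightarrow> S (w ^ (j * q)) = 0"
proof -
  have S_in: "S (w ^ j) \<in> int_adjoin w" for j
    unfolding S_def by (intro int_adjoin_sum int_adjoin.intros int_adjoin_power)
  have "\<exists>c y. c \<noteq> 0 \<and> y \<in> int_adjoin w \<and> S (w ^ j) * y = of_int c" if "S (w ^ j) \<noteq> 0" for j
  proof -
    obtain p where "poly (map_poly of_int p) (S (w ^ j)) = 0" "lead_coeff p = 1"
      using algebraic_int_int_adjoin[OF w S_in] unfolding algebraic_int_altdef_ipoly by blast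
    then show ?thesis
      using that by (intro int_adjoin_dvd_int[OF _ _ S_in]) auto
  qed
  then obtain c y where c: "\<And>j. S (w ^ j) \<noteq> 0 \<Longrightarrow> c j \<noteq> 0"
    and y: "\<And>j. S (w ^ j) \<noteq> 0 \<Longrightarrow> y j \<in> int_adjoin w"
    and cy: "\<And>j. S (w ^ j) \<noteq> 0 \<Longrightarrow> S (w ^ j) * y j = of_int (c j)"
    by metis
  \<comment> \<open>\<open>w ^ j\<close> depends only on \<open>j\<close> modulo \<open>n\<close>,
    so the \<open>c j\<close> with \<open>j < n\<close> suffice; a prime above the sum of their
    absolute values divides no nonzero one.\<close>
  define B where "B = (\<Sum>j<n. nat \<bar>c j\<bar>)"
  have "S (w ^ (j * q)) = 0" if q: "prime q" "q > B" and 0: "S (w ^ j) = 0" for q j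
  proof (rule ccontr)
    assume nz: "S (w ^ (j * q)) \<noteq> 0"
    define k where "k = (j * q) mod n"
    have k: "k < n" "w ^ k = w ^ (j * q)"
      using w by (auto simp: k_def power_mod_root_of_unity)
    have q0: "q > 0" using q(1) prime_gt_0_nat by blast
    obtain r where r: "r \<in> int_adjoin w"
        "S (w ^ j) ^ q = (\<Sum>i\<in>X. (of_int (a i) * (w ^ j) ^ e i) ^ q) + of_nat q * r"
      unfolding S_def
      using int_adjoin_sum_power_prime[OF q(1) X, of "\<lambda>i. of_int (a i) * (w ^ j) ^ e i" w]
      by (auto intro: int_adjoin.intros int_adjoin_power)
    \<comment> \<open>Fermat's little theorem trades the coefficient \<open>a i ^ q\<close> for
      \<open>a i\<close> at the cost of another multiple of \<open>q\<close>.\<close>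
    have "\<forall>i. \<exists>d. a i ^ q = a i + int q * d"
      using fermat_int[OF q(1)] by (metis cong_iff_lin cong_sym mult.commute)
    then obtain d where d: "\<And>i. a i ^ q = a i + int q * d i" by metis
    define s where "s = (\<Sum>i\<in>X. of_int (d i) * ((w ^ j) ^ e i) ^ q)"
    have s: "s \<in> int_adjoin w"
      unfolding s_def by (intro int_adjoin_sum int_adjoin.intros int_adjoin_power)
    have "(\<Sum>i\<in>X. (of_int (a i) * (w ^ j) ^ e i) ^ q) =
        (\<Sum>i\<in>X. of_int (a i ^ q) * ((w ^ j) ^ e i) ^ q)"
      by (simp add: power_mult_distrib)
    also have "\<dots> = (\<Sum>i\<in>X. of_int (a i) * ((w ^ j) ^ e i) ^ q) + of_nat q * s"
      by (simp add: d s_def sum.distrib sum_distrib_left algebra_simps)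
    also have "(\<Sum>i\<in>X. of_int (a i) * ((w ^ j) ^ e i) ^ q) = S (w ^ (j * q))"
      unfolding S_def by (simp add: power_mult[symmetric] mult_ac)
    finally have "S (w ^ j) ^ q = S (w ^ k) + of_nat q * (r + s)"
      unfolding r(2) k(2) by (simp add: distrib_left)
    then have Sq: "S (w ^ k) = - (of_nat q * (r + s))"
      unfolding 0 zero_power[OF q0] by (simp only: eq_neg_iff_add_eq_0)
    have nz': "S (w ^ k) \<noteq> 0" using nz k by simp
    \<comment> \<open>Since \<open>S (w ^ k)\<close> is \<open>q\<close> times an element of
      \<open>\<int>[w]\<close> and divides \<open>c k\<close>, the number \<open>b = c k / q\<close>
      is rational and an algebraic integer. Hence \<open>q\<close> divides \<open>c k\<close>,
      against the size of \<open>q\<close>.\<close>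
    define b where "b = - ((r + s) * y k)"
    have "b \<in> int_adjoin w"
      unfolding b_def using r s y[OF nz'] by (intro int_adjoin_minus int_adjoin.intros)
    then have "algebraic_int b" by (rule algebraic_int_int_adjoin[OF w])
    moreover have bq: "of_nat q * b = of_int (c k)"
      using cy[OF nz'] Sq by (simp add: b_def algebra_simps)
    then have "b = of_int (c k) / of_nat q" using q0 by (simp add: field_simps)
    then have "b \<in> \<rat>" by simp
    ultimately have "b \<in> \<int>" by (rule rational_algebraic_int_is_int)
    then obtain b' where "b = of_int b'" by (auto elim: Ints_cases)
    then have "complex_of_int (int q * b') = of_int (c k)" using bq by simp
    then have "int q * b' = c k" by (simp only: of_int_eq_iff)
    then have "int q dvd c k" by (metis dvd_triv_left)
    then have "int q \<le> \<bar>c k\<bar>" using dvd_imp_le_int[OF c[OF nz'], of "int q"] by simp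
    moreover have "nat \<bar>c k\<bar> \<le> B"
      unfolding B_def using k(1) by (intro member_le_sum) auto
    ultimately show False using q(2) by linarith
  qed
  then show ?thesis by blast
qed

section \<open>From large primes to all exponents prime to n\<close>

text \<open>The witness is \<open>v + n * P\<close> with \<open>P\<close> the product of the primes
  up to \<open>B\<close> not dividing \<open>v\<close>: a small prime divides exactly one of
  \<open>v\<close> and \<open>n * P\<close>, hence not their sum.\<close>

lemma coprime_shift_no_small_primes:
  fixes v n B :: nat
  assumes "coprime v n" "n > 0"
  shows "\<exists>u. u > 0 \<and> [u = v] (mod n) \<and> (\<forall>p. prime p \<longrightarrow> p dvd u \<longrightarrow> p > B)"
proof -
  define P where "P = \<Prod>{p. prime p \<and> p \<le> B \<and> \<not> p dvd v}"
  have fin: "finite {p. prime p \<and> p \<le> B \<and> \<not> p dvd v}"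
    by (rule finite_subset[of _ "{..B}"]) auto
  have P: "P > 0" unfolding P_def by (intro prod_pos) (auto simp: prime_gt_0_nat)
  have "p > B" if p: "prime p" "p dvd v + n * P" for p
  proof (rule ccontr)
    assume "\<not> p > B"
    show False
    proof (cases "p dvd v")
      case True
      then have "p dvd n * P" using p(2) by (simp add: dvd_add_right_iff)
      moreover have "\<not> p dvd n" using True p(1) assms(1)
        by (meson coprime_common_divisor not_prime_unit)
      ultimately have "p dvd P" using p(1) prime_dvd_mult_iff by blast
      then obtain p' where "prime p'" "\<not> p' dvd v" "p dvd p'"
        unfolding P_def using prime_dvd_prod_iff[OF fin p(1)] by auto
      then show False using True p(1) primes_dvd_imp_eq by blast
    next
      case False
      then have "p dvd P"
        unfolding P_def using \<open>\<not> p > B\<close> p(1) fin by (intro dvd_prodI[of _ _ "\<lambda>x. x", simplified]) auto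
      then show False using False p(2) by (simp add: dvd_add_left_iff)
    qed
  qed
  moreover have "[v + n * P = v] (mod n)" by (simp add: cong_def)
  ultimately show ?thesis using P assms(2) by (intro exI[of _ "v + n * P"]) auto
qed

text \<open>The exponent \<open>v\<close> is replaced by a congruent \<open>u\<close> all of whose
  prime factors are large, and these are applied one after another.\<close>

lemma vanishing_int_sum_conjugate:
  fixes w :: complex and a :: "'i \<Rightarrow> int" and e :: "'i \<Rightarrow> nat"
  assumes w: "w ^ n = 1" "n > 0" and X: "finite X" and v: "coprime v n"
    and 0: "(\<Sum>i\<in>X. of_int (a i) * w ^ e i) = 0"
  shows "(\<Sum>i\<in>X. of_int (a i) * (w ^ v) ^ e i) = 0"
proof -
  define S where "S = (\<lambda>z::complex. \<Sum>i\<in>X. of_int (a i) * z ^ e i)"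
  obtain B where B: "\<And>q j. prime q \<Longrightarrow> q > B \<Longrightarrow> S (w ^ j) = 0 \<Longrightarrow> S (w ^ (j * q)) = 0"
    using vanishing_sum_power_large_prime[OF w X, of a e] unfolding S_def by blast
  obtain u where u: "u > 0" "[u = v] (mod n)" "\<forall>p. prime p \<longrightarrow> p dvd u \<longrightarrow> p > B"
    using coprime_shift_no_small_primes[OF v w(2)] by blast
  \<comment> \<open>The claim is for all \<open>j\<close>, because after a prime \<open>p\<close> is
    split off the induction continues from \<open>j * p\<close>.\<close>
  have "S (w ^ j) = 0 \<Longrightarrow> S (w ^ (j * u)) = 0" for j
    using u(1,3)
  proof (induction u arbitrary: j rule: less_induct)
    case (less u)
    show ?case
    proof (cases "u = 1")
      case False
      then obtain p where p: "prime p" "p dvd u" using prime_factor_nat by blast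
      then obtain t where t: "u = p * t" by blast
      have "t > 0" "t < u" using t less.prems(2) prime_gt_1_nat[OF p(1)] by auto
      moreover have "S (w ^ (j * p)) = 0" using B p less.prems by blast
      ultimately have "S (w ^ (j * p * t)) = 0" using less.IH less.prems(3) t by simp
      then show ?thesis by (simp add: t mult.assoc)
    qed (use less.prems in simp)
  qed
  from this[of 1] have "S (w ^ u) = 0" using 0 by (simp add: S_def)
  moreover have "w ^ u = w ^ v"
    using u(2) power_mod_root_of_unity[OF w(1)] by (metis cong_def)
  ultimately show ?thesis by (simp add: S_def)
qed

lemma finite_Rats_common_denominator:
  fixes a :: "'i \<Rightarrow> 'a::field_char_0"
  assumes "finite X" "\<And>i. i \<in> X \<Longrightarrow> a i \<in> \<rat>"
  shows "\<exists>(D::int) b. D \<noteq> 0 \<and> (\<forall>i\<in>X. of_int D * a i = of_int (b i))"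
  using assms
proof (induction X)
  case empty
  then show ?case by (intro exI[of _ 1]) auto
next
  case (insert x X)
  then obtain D b where D: "D \<noteq> 0" "\<And>i. i \<in> X \<Longrightarrow> of_int D * a i = of_int (b i)" by auto
  obtain m k where mk: "a x = of_int m / of_int k" "k > 0"
    using insert.prems[of x] by (auto elim: Rats_cases')
  show ?case
  proof (intro exI[of _ "D * k"] exI[of _ "\<lambda>i. if i = x then D * m else k * b i"] conjI ballI)
    show "D * k \<noteq> 0" using D mk by simp
    fix i assume "i \<in> insert x X"
    then show "of_int (D * k) * a i = of_int (if i = x then D * m else k * b i)"
      using D(2)[of i] mk by (auto simp: mult_ac)
  qed
qed

text \<open>After clearing denominators the integer case applies. This is the action of the Galois
  automorphism sending \<open>w\<close> to \<open>w ^ v\<close>, in the elementary form needed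
  later.\<close>

lemma vanishing_rat_sum_conjugate:
  fixes w :: complex and a :: "'i \<Rightarrow> complex" and e :: "'i \<Rightarrow> nat"
  assumes w: "w ^ n = 1" "n > 0" and X: "finite X" and v: "coprime v n"
    and a: "\<And>i. i \<in> X \<Longrightarrow> a i \<in> \<rat>"
    and 0: "(\<Sum>i\<in>X. a i * w ^ e i) = 0"
  shows "(\<Sum>i\<in>X. a i * (w ^ v) ^ e i) = 0"
proof -
  have "\<exists>D b. D \<noteq> 0 \<and> (\<forall>i\<in>X. of_int D * a i = of_int (b i))"
    by (rule finite_Rats_common_denominator[OF X a])
  then obtain D b where "D \<noteq> 0 \<and> (\<forall>i\<in>X. of_int D * a i = of_int (b i))"
    by (elim exE)
  then have D: "D \<noteq> 0" "\<And>i. i \<in> X \<Longrightarrow> of_int D * a i = of_int (b i)"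
    by simp_all
  have eq: "of_int D * (\<Sum>i\<in>X. a i * z ^ e i) = (\<Sum>i\<in>X. of_int (b i) * z ^ e i)" for z
    unfolding sum_distrib_left by (intro sum.cong refl) (simp add: D(2)[symmetric] mult.assoc)
  have "(\<Sum>i\<in>X. of_int (b i) * (w ^ v) ^ e i) = 0"
    using eq[of w] 0 by (intro vanishing_int_sum_conjugate[OF w X v]) simp
  then show ?thesis using eq[of "w ^ v"] D(1) by simp
qed

section \<open>Sums of units modulo an integer\<close>

text \<open>Induction on the set of primes: shifting \<open>u\<close> by multiples of the product
  \<open>M\<close> of the earlier primes keeps their conditions, and a suitable multiple meets the
  condition at the new prime.\<close>

lemma ex_int_avoiding_residues:
  fixes a :: int
  assumes "finite Q" "\<And>p. p \<in> Q \<Longrightarrow> prime p" "2 \<in> Q \<Longrightarrow> even a"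
  shows "\<exists>u. \<forall>p\<in>Q. \<not> p dvd u \<and> \<not> p dvd a - u"
  using assms
proof (induction Q)
  case empty
  then show ?case by simp
next
  case (insert p Q)
  obtain u where u: "\<And>q. q \<in> Q \<Longrightarrow> \<not> q dvd u \<and> \<not> q dvd a - u"
    using insert by blast
  define M where "M = \<Prod>Q"
  have p: "prime p" using insert.prems by simp
  have "\<not> p dvd q" if "q \<in> Q" for q
    using that insert.hyps insert.prems primes_dvd_imp_eq by blast
  then have pM: "\<not> p dvd M"
    unfolding M_def using prime_dvd_prod_iff[OF insert.hyps(1) p] by auto
  have QM: "q dvd k * M" if "q \<in> Q" for q k
    unfolding M_def using that insert.hyps(1) by (intro dvd_mult dvd_prodI[of _ _ "\<lambda>x. x", simplified])
  have "\<exists>k. \<not> p dvd u + k * M \<and> \<not> p dvd a - (u + k * M)"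
  proof (cases "p = 2")
    case True
    \<comment> \<open>For even \<open>a\<close> both conditions at 2 say that the shifted number is
      odd, and adding the odd \<open>M\<close> changes parity.\<close>
    then have "even a" "odd M" using insert.prems(2) pM by auto
    then show ?thesis using True by (intro exI[of _ "if odd u then 0 else 1"]) auto
  next
    case False
    have "\<not> p dvd 2" using False p primes_dvd_imp_eq[of p 2] by auto
    then have p2M: "\<not> p dvd 2 * M" using pM p by (simp add: prime_dvd_mult_iff)
    \<comment> \<open>There are three candidates \<open>k = 0, 1, 2\<close> and two excluded
      residues. As \<open>p\<close> divides neither \<open>M\<close> nor \<open>2 * M\<close>, each
      residue rules out at most one candidate.\<close>
    have diff: "\<not> (p dvd x \<and> p dvd y)" if "y - x \<in> {M, - M, 2 * M, - (2 * M)}" for x y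
    proof
      assume "p dvd x \<and> p dvd y"
      then have "p dvd y - x" by simp
      then show False using that pM p2M by (elim insertE emptyE) (simp_all only: dvd_minus_iff simp_thms)
    qed
    show ?thesis
    proof (rule ccontr)
      assume "\<not> ?thesis"
      then have "p dvd u + k * M \<or> p dvd a - (u + k * M)" for k by blast
      from this[of 0] this[of 1] this[of 2] show False
        using diff[of "u + M" u] diff[of "u + 2 * M" u] diff[of "u + 2 * M" "u + M"]
          diff[of "a - (u + M)" "a - u"] diff[of "a - (u + 2 * M)" "a - u"]
          diff[of "a - (u + 2 * M)" "a - (u + M)"] by auto
    qed
  qed
  then obtain k where k: "\<not> p dvd u + k * M" "\<not> p dvd a - (u + k * M)" by blast
  have "\<not> q dvd u + k * M \<and> \<not> q dvd a - (u + k * M)" if "q \<in> Q" for q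
  proof -
    have "a - u = (a - (u + k * M)) + k * M" by simp
    then show ?thesis using u[OF that] QM[OF that, of k]
      by (metis dvd_add dvd_add_left_iff)
  qed
  then show ?case using k by (intro exI[of _ "u + k * M"]) auto
qed

text \<open>For even \<open>n\<close> both summands are odd, which forces \<open>a\<close> to be
  even; the other prime factors of \<open>n\<close> give no obstruction.\<close>

lemma int_eq_sum_two_coprime:
  fixes a n :: int
  assumes "n \<noteq> 0" "even n \<Longrightarrow> even a"
  shows "\<exists>u. coprime u n \<and> coprime (a - u) n"
proof -
  have "\<exists>u. \<forall>p\<in>prime_factors n. \<not> p dvd u \<and> \<not> p dvd a - u"
    using assms by (intro ex_int_avoiding_residues) (auto simp: in_prime_factors_iff)
  then obtain u where u: "\<And>p. p \<in> prime_factors n \<Longrightarrow> \<not> p dvd u \<and> \<not> p dvd a - u" by blast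
  have "coprime x n" if "\<And>p. p \<in> prime_factors n \<Longrightarrow> \<not> p dvd x" for x
  proof (rule ccontr)
    assume "\<not> coprime x n"
    then have "\<not> is_unit (gcd x n)" by (simp add: coprime_iff_gcd_eq_1)
    moreover have "gcd x n \<noteq> 0" using assms(1) by simp
    ultimately obtain p where "prime p" "p dvd gcd x n"
      using prime_divisor_exists by blast
    then show False using that[of p] assms(1) by (auto simp: in_prime_factors_iff)
  qed
  then show ?thesis using u by blast
qed

text \<open>Two units fail only for even \<open>n\<close> and odd \<open>a\<close>. Then
  \<open>a\<close> is itself a unit if \<open>n\<close> is a power of 2; otherwise the unit 1 is
  split off and the even number \<open>a - 1\<close> is a sum of two.\<close>

lemma int_eq_sum_list_coprime:
  fixes a :: int and n :: nat
  assumes "n > 1"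
  shows "\<exists>L. (\<forall>u\<in>set L. coprime u (int n)) \<and> sum_list L = a \<and>
     length L \<le> (if odd n \<or> (\<exists>m. n = 2 ^ m) then 2 else 3)"
proof (cases "even n \<longrightarrow> even a")
  case True
  then obtain u where "coprime u (int n)" "coprime (a - u) (int n)"
    using int_eq_sum_two_coprime[of "int n" a] assms by auto
  then show ?thesis by (intro exI[of _ "[u, a - u]"]) auto
next
  case False
  show ?thesis
  proof (cases "\<exists>m. n = 2 ^ m")
    case True
    then have "coprime a (int n)" using False
      by (auto simp: coprime_commute)
    then show ?thesis by (intro exI[of _ "[a]"]) auto
  next
    case n: False
    obtain u where "coprime u (int n)" "coprime (a - 1 - u) (int n)"
      using int_eq_sum_two_coprime[of "int n" "a - 1"] assms False by auto
    then show ?thesis using n False by (intro exI[of _ "[1, u, a - 1 - u]"]) auto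
  qed
qed

section \<open>Extension from generators to a homomorphism\<close>

text \<open>A sum of at most \<open>2s\<close> elements of \<open>T\<close> minus the chosen representation of its value, of length
  at most \<open>s\<close>, is a relation of length at most \<open>3s\<close>; this makes the extension of \<open>h\<close> independent of
  all choices.\<close>

lemma multiplicative_extension:
  fixes h :: "'v::ab_group_add \<Rightarrow> 'f::field"
  assumes K: "\<And>v w. v \<in> K \<Longrightarrow> w \<in> K \<Longrightarrow> v - w \<in> K" "0 \<in> K"
    and T: "\<And>t. t \<in> T \<Longrightarrow> - t \<in> T"
    and h: "\<And>L. set L \<subseteq> T \<Longrightarrow> length L \<le> 3 * s \<Longrightarrow> sum_list L \<in> K \<Longrightarrow> prod_list (map h L) = 1"
    and gen: "\<And>v. \<exists>L. set L \<subseteq> T \<and> length L \<le> s \<and> v - sum_list L \<in> K"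
    and s: "s > 0"
  shows "\<exists>H. (\<forall>v w. H (v + w) = H v * H w) \<and> (\<forall>t\<in>T. H t = h t) \<and> (\<forall>v\<in>K. H v = 1)"
proof -
  obtain R where R: "\<And>v. set (R v) \<subseteq> T" "\<And>v. length (R v) \<le> s" "\<And>v. v - sum_list (R v) \<in> K"
    using gen by metis
  define H where "H v = prod_list (map h (R v))" for v
  \<comment> \<open>The relation \<open>t + (- t) = 0\<close> has length 2, which is at most
    \<open>3 * s\<close> because \<open>s > 0\<close>; so \<open>h\<close> is invertible on
    \<open>T\<close>.\<close>
  have inv: "h t * h (- t) = 1" if "t \<in> T" for t
    using h[of "[t, - t]"] that T K(2) s by simp
  have cancel: "prod_list (map h L) * prod_list (map h (map uminus L)) = 1" if "set L \<subseteq> T" for L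
    using that
  proof (induction L)
    case (Cons t L)
    have "prod_list (map h (t # L)) * prod_list (map h (map uminus (t # L))) =
        (h t * h (- t)) * (prod_list (map h L) * prod_list (map h (map uminus L)))"
      by (simp add: mult_ac)
    also have "\<dots> = 1" using Cons inv[of t] by (simp only: list.set insert_subset) simp
    finally show ?case .
  qed simp
  have sum_neg: "sum_list (map uminus L) = - sum_list L" for L :: "'v list"
    by (induction L) auto
  have key: "prod_list (map h L) = H v"
    if L: "set L \<subseteq> T" "length L \<le> 2 * s" "v - sum_list L \<in> K" for L v
  proof -
    have "(v - sum_list (R v)) - (v - sum_list L) \<in> K" using K(1) R(3) L(3) by blast
    then have "sum_list (L @ map uminus (R v)) \<in> K" by (simp add: sum_neg)
    then have "prod_list (map h (L @ map uminus (R v))) = 1"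
      using L(1,2) R[of v] T by (intro h) auto
    then have "prod_list (map h L) * prod_list (map h (map uminus (R v))) = 1" by simp
    moreover have "H v * prod_list (map h (map uminus (R v))) = 1"
      unfolding H_def using R(1) by (rule cancel)
    ultimately show ?thesis by (metis mult_cancel_right mult_zero_right zero_neq_one)
  qed
  show ?thesis
  proof (intro exI[of _ H] conjI allI ballI)
    fix v w
    \<comment> \<open>Two chosen representations together have length at most \<open>2 * s\<close>,
      within the reach of \<open>key\<close>.\<close>
    have "(v - sum_list (R v)) - (0 - (w - sum_list (R w))) \<in> K" using K R(3) by blast
    then have "v + w - sum_list (R v @ R w) \<in> K" by (simp add: algebra_simps)
    then have "prod_list (map h (R v @ R w)) = H (v + w)"
      using R[of v] R[of w] by (intro key) auto
    then show "H (v + w) = H v * H w" by (simp add: H_def)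
  next
    fix t assume "t \<in> T"
    then show "H t = h t" using key[of "[t]" t] K(2) s by simp
  next
    fix v assume "v \<in> K"
    then show "H v = 1" using key[of "[]" v] by simp
  qed
qed

section \<open>Characters and Fourier transforms\<close>

text \<open>The same root of unity as in \<open>e1\<close>, but for every integer \<open>k\<close>,
  so that it is additive without reduction modulo \<open>N\<close>.\<close>

definition root_char :: "nat \<Rightarrow> int \<Rightarrow> complex" where
  "root_char N k = cis (2 * pi * of_int k / of_nat N)"

lemma root_char_add: "root_char N (a + b) = root_char N a * root_char N b"
  by (simp add: root_char_def cis_mult add_divide_distrib ring_distribs)

lemma root_char_0 [simp]: "root_char N 0 = 1"
  by (simp add: root_char_def)

lemma root_char_minus: "root_char N (- a) = cnj (root_char N a)"
  by (simp add: root_char_def cis_cnj)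

lemma norm_root_char [simp]: "norm (root_char N a) = 1"
  by (simp add: root_char_def)

lemma root_char_mult_nat: "root_char N (a * int k) = root_char N a ^ k"
  by (induction k) (simp_all add: root_char_add ring_distribs mult.commute)

lemma root_char_eq_1_iff:
  assumes "N > 0"
  shows "root_char N a = 1 \<longleftrightarrow> int N dvd a"
proof
  assume "root_char N a = 1"
  then have "cos (2 * pi * of_int a / of_nat N) = 1"
    by (simp add: root_char_def complex_eq_iff)
  then obtain m where "2 * pi * of_int a / of_nat N = of_int m * 2 * pi"
    using cos_one_2pi_int by blast
  then have "real_of_int a = of_int (m * int N)" using assms by (simp add: field_simps)
  then have "a = m * int N" by (simp only: of_int_eq_iff)
  then show "int N dvd a" by simp
next
  assume "int N dvd a"
  then obtain m where a: "a = int N * m" by blast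
  have "2 * pi * of_int a / of_nat N = 2 * pi * of_int m" using assms by (simp add: a)
  then show "root_char N a = 1" by (simp add: root_char_def cis_multiple_2pi)
qed

lemma root_char_cong:
  assumes "N > 0" "[a = b] (mod int N)"
  shows "root_char N a = root_char N b"
proof -
  have "root_char N (a - b) = 1"
    using assms by (simp add: root_char_eq_1_iff cong_iff_dvd_diff)
  then show ?thesis using root_char_add[of N "a - b" b] by simp
qed

text \<open>A geometric sum whose ratio is an \<open>N\<close>-th root of unity other than
  1.\<close>

lemma sum_root_char_eq_0:
  assumes "N > 0" "\<not> int N dvd a"
  shows "(\<Sum>k<N. root_char N (int k * a)) = 0"
proof -
  have "(\<Sum>k<N. root_char N (int k * a)) = (\<Sum>k<N. root_char N a ^ k)"
    by (simp add: root_char_mult_nat[symmetric] mult.commute)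
  moreover have "root_char N a ^ N = 1"
    using assms(1) by (simp add: root_char_mult_nat[symmetric] root_char_eq_1_iff)
  moreover have "root_char N a \<noteq> 1" using assms by (simp add: root_char_eq_1_iff)
  ultimately show ?thesis by (simp add: sum_gp_strict)
qed

section \<open>Pairing of integer vectors and duality\<close>

definition pairing :: "'i set \<Rightarrow> ('i \<Rightarrow> nat) \<Rightarrow> ('i \<Rightarrow> int) \<Rightarrow> ('i \<Rightarrow> int) \<Rightarrow> complex" where
  "pairing I N m y = (\<Prod>j\<in>I. root_char (N j) (m j * y j))"

lemma pairing_add_left: "pairing I N (m + m') y = pairing I N m y * pairing I N m' y"
  by (simp add: pairing_def ring_distribs root_char_add prod.distrib)

lemma pairing_add_right: "pairing I N m (y + y') = pairing I N m y * pairing I N m y'"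
  by (simp add: pairing_def ring_distribs root_char_add prod.distrib)

lemma pairing_0_left [simp]: "pairing I N 0 y = 1"
  by (simp add: pairing_def)

lemma pairing_minus_left: "pairing I N (- m) y = cnj (pairing I N m y)"
  by (simp add: pairing_def root_char_minus)

lemma norm_pairing [simp]: "norm (pairing I N m y) = 1"
  by (simp add: pairing_def prod_norm[symmetric])

lemma pairing_sum_list_left:
  "pairing I N (sum_list L) y = prod_list (map (\<lambda>m. pairing I N m y) L)"
  by (induction L) (simp_all add: pairing_add_left del: plus_fun_apply zero_fun_apply)

lemma pairing_cong_right:
  assumes "\<And>j. j \<in> I \<Longrightarrow> N j > 0" "\<And>j. j \<in> I \<Longrightarrow> [y j = y' j] (mod int (N j))"
  shows "pairing I N m y = pairing I N m y'"
  unfolding pairing_def using assms by (intro prod.cong refl root_char_cong cong_scalar_left) auto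

lemma pairing_single_left:
  assumes "finite I" "i \<in> I"
  shows "pairing I N (\<lambda>j. if j = i then u else 0) y = root_char (N i) (u * y i)"
proof -
  have "pairing I N (\<lambda>j. if j = i then u else 0) y =
      (\<Prod>j\<in>I. if j = i then root_char (N i) (u * y i) else 1)"
    unfolding pairing_def by (intro prod.cong refl) auto
  then show ?thesis using assms by simp
qed

lemma sum_pairing_eq_0:
  assumes "finite I" "\<And>j. j \<in> I \<Longrightarrow> N j > 0" "i \<in> I" "\<not> int (N i) dvd y i"
  shows "(\<Sum>m\<in>(\<Pi>\<^sub>E j\<in>I. {..<N j}). pairing I N (\<lambda>j. int (m j)) y) = 0"
proof -
  have "(\<Sum>m\<in>(\<Pi>\<^sub>E j\<in>I. {..<N j}). pairing I N (\<lambda>j. int (m j)) y) =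
      (\<Prod>j\<in>I. \<Sum>k<N j. root_char (N j) (int k * y j))"
    unfolding pairing_def using assms(1) by (subst prod_sum_PiE) auto
  also have "\<dots> = 0"
    using assms sum_root_char_eq_0[of "N i" "y i"] by (intro prod_zero) auto
  finally show ?thesis .
qed

text \<open>Finite Pontryagin duality. By \<open>one\<close>, the value of \<open>H\<close> at each
  unit vector is an \<open>N i\<close>-th root of unity, whose exponent becomes the coordinate of
  \<open>a\<close>. The quotient \<open>Q\<close> of \<open>H\<close> by the pairing is then 1 on
  unit vectors, and hence everywhere.\<close>

lemma multiplicative_eq_pairing:
  fixes H :: "('i \<Rightarrow> int) \<Rightarrow> complex"
  assumes I: "finite I" "\<And>i. i \<in> I \<Longrightarrow> N i > 0"
    and add: "\<And>v w. H (v + w) = H v * H w"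
    and one: "\<And>v. (\<And>i. i \<in> I \<Longrightarrow> int (N i) dvd v i) \<Longrightarrow> H v = 1"
  shows "\<exists>a\<in>(\<Pi>\<^sub>E i\<in>I. {0..<int (N i)}). \<forall>v. H v = pairing I N v a"
proof -
  define e where "e i u = (\<lambda>j. if j = i then u else 0)" for i :: 'i and u :: int
  have e_add: "e i (u + u') = e i u + e i u'" for i u u'
    by (auto simp: e_def fun_eq_iff)
  have e_0: "e i 0 = 0" for i by (auto simp: e_def fun_eq_iff)
  have H0: "H 0 = 1" by (intro one) simp
  have "\<exists>a. a \<in> {0..<int (N i)} \<and> H (e i 1) = root_char (N i) a" if i: "i \<in> I" for i
  proof -
    have "H (e i (int k)) = H (e i 1) ^ k" for k
      by (induction k) (simp_all add: e_0 H0 e_add add mult.commute del: plus_fun_apply zero_fun_apply)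
    from this[of "N i"] have "H (e i 1) ^ N i = 1"
      using one[of "e i (int (N i))"] by (simp add: e_def)
    then obtain k where "k < N i" "H (e i 1) = cis (2 * pi * real k / real (N i))"
      using bij_betw_roots_unity[OF I(2)[OF i]] unfolding bij_betw_def by auto
    then show ?thesis by (intro exI[of _ "int k"]) (auto simp: root_char_def)
  qed
  then obtain a where a: "\<And>i. i \<in> I \<Longrightarrow> a i \<in> {0..<int (N i)}"
      "\<And>i. i \<in> I \<Longrightarrow> H (e i 1) = root_char (N i) (a i)"
    by metis
  define b where "b = restrict a I"
  define Q where "Q v = H v * pairing I N (- v) b" for v
  have Q_add: "Q (v + w) = Q v * Q w" for v w
    unfolding Q_def add minus_add_distrib pairing_add_left by (simp only: mult_ac)
  have Q0: "Q 0 = 1" by (simp add: Q_def H0)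
  have unit: "root_char n k * cnj (root_char n k) = 1" for n k
    by (metis add.right_inverse root_char_0 root_char_add root_char_minus)
  have Q1: "Q (e i 1) = 1" if "i \<in> I" for i
    unfolding Q_def e_def pairing_minus_left pairing_single_left[OF I(1) that]
    using a(2)[OF that] that by (simp add: e_def b_def unit)
  have Qe: "Q (e i u) = 1" if "i \<in> I" for i u
  proof (induction u rule: int_induct[of _ 0])
    case base
    then show ?case unfolding e_0 by (rule Q0)
  next
    case (step1 u)
    then show ?case using Q1[OF that] by (simp add: e_add Q_add del: plus_fun_apply zero_fun_apply)
  next
    case (step2 u)
    then show ?case using Q1[OF that] Q_add[of "e i (u - 1)" "e i 1"]
      by (simp flip: e_add)
  qed
  have Qs: "Q (\<Sum>i\<in>J. e i (v i)) = 1" if "finite J" "J \<subseteq> I" for J v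
    using that by (induction J) (auto simp: Q0 Q_add Qe simp del: plus_fun_apply zero_fun_apply)
  have "Q v = 1" for v
  proof -
    \<comment> \<open>Outside \<open>I\<close> the vector \<open>v\<close> need not agree with the
      sum of unit vectors; the remainder \<open>w\<close> vanishes on \<open>I\<close> and is
      covered by \<open>one\<close>.\<close>
    define w where "w = v - (\<Sum>i\<in>I. e i (v i))"
    have sum_apply: "(\<Sum>i\<in>J. e i (v i)) j = (\<Sum>i\<in>J. e i (v i) j)" if "finite J" for J j
      using that by (induction J) auto
    have w: "w j = 0" if "j \<in> I" for j
      using that I(1) by (simp add: w_def sum_apply) (simp add: e_def)
    have "Q w = 1"
      unfolding Q_def using w by (simp add: one) (simp add: pairing_def)
    moreover have "v = w + (\<Sum>i\<in>I. e i (v i))" by (simp add: w_def)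
    ultimately show ?thesis using Q_add Qs[OF I(1)] by (metis mult_1 order_refl)
  qed
  then have "H v = pairing I N v b" for v
    using add[of v 0] pairing_add_left[of I N "- v" v b]
    by (simp add: Q_def) (metis mult.assoc mult.right_neutral mult_1)
  moreover have "b \<in> (\<Pi>\<^sub>E i\<in>I. {0..<int (N i)})" using a(1) by (auto simp: b_def)
  ultimately show ?thesis by blast
qed

section \<open>Fourier transforms of autocorrelations\<close>

text \<open>Membership in \<open>hom G circle_group\<close> spelled out, without the extensionality
  demanded by \<open>dual_group\<close>.\<close>

definition unitary_character_on :: "('a, 'b) monoid_scheme \<Rightarrow> ('a \<Rightarrow> complex) \<Rightarrow> bool" where
  "unitary_character_on G c \<longleftrightarrow> (\<forall>x\<in>carrier G. norm (c x) = 1) \<and>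
     (\<forall>x\<in>carrier G. \<forall>y\<in>carrier G. c (x \<otimes>\<^bsub>G\<^esub> y) = c x * c y)"

lemma unitary_mult_cnj: "norm z = 1 \<Longrightarrow> z * cnj z = 1"
  by (metis complex_norm_square of_real_1 one_power2)

lemma fourier_transform_shift:
  fixes G (structure)
  assumes "group G" "unitary_character_on G c" "a \<in> carrier G"
  shows "fourier_transform G (\<lambda>x. f (a \<otimes> x)) c = c a * fourier_transform G f c"
proof -
  interpret group G by fact
  have c: "cnj (c x) = c a * cnj (c (a \<otimes> x))" if "x \<in> carrier G" for x
  proof -
    have "c a * cnj (c (a \<otimes> x)) = (c a * cnj (c a)) * cnj (c x)"
      using assms that unfolding unitary_character_on_def by simp
    also have "c a * cnj (c a) = 1"
      using assms unfolding unitary_character_on_def by (simp add: unitary_mult_cnj)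
    finally show ?thesis by simp
  qed
  have "fourier_transform G (\<lambda>x. f (a \<otimes> x)) c =
      (\<Sum>x\<in>carrier G. c a * (f (a \<otimes> x) * cnj (c (a \<otimes> x))))"
    unfolding fourier_transform_def by (intro sum.cong refl) (simp add: c mult_ac)
  also have "\<dots> = c a * (\<Sum>x\<in>carrier G. f (a \<otimes> x) * cnj (c (a \<otimes> x)))"
    by (simp add: sum_distrib_left)
  also have "(\<Sum>x\<in>carrier G. f (a \<otimes> x) * cnj (c (a \<otimes> x))) = (\<Sum>x\<in>carrier G. f x * cnj (c x))"
  proof (rule sum.reindex_bij_witness[of _ "\<lambda>y. inv a \<otimes> y" "\<lambda>x. a \<otimes> x"])
  qed (use assms(3) in \<open>auto simp: m_assoc[symmetric]\<close>)
  finally show ?thesis by (simp add: fourier_transform_def)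
qed

text \<open>For fixed \<open>x\<close> the sum over \<open>t\<close> factorises into transforms of
  shifted copies of \<open>f\<close>, each contributing \<open>c i x\<close>. These factors turn the
  remaining sum over \<open>x\<close> into the transform at the inverse of the product of the
  \<open>c i\<close>.\<close>

lemma fourier_transform_autocorrelation:
  fixes G (structure)
  assumes "group G" "finite (carrier G)" "\<And>i. i \<in> {1..<n} \<Longrightarrow> unitary_character_on G (c i)"
  shows "(\<Sum>t\<in>(\<Pi>\<^sub>E i\<in>{1..<n}. carrier G). autocorrelation G n f t * (\<Prod>i\<in>{1..<n}. cnj (c i (t i)))) =
     fourier_transform G f (\<lambda>x. cnj (\<Prod>i\<in>{1..<n}. c i x)) * (\<Prod>i\<in>{1..<n}. fourier_transform G f (c i))"
proof -
  let ?P = "\<Pi>\<^sub>E i\<in>{1..<n}. carrier G"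
  have "(\<Sum>t\<in>?P. autocorrelation G n f t * (\<Prod>i\<in>{1..<n}. cnj (c i (t i)))) =
      (\<Sum>t\<in>?P. \<Sum>x\<in>carrier G. f x * (\<Prod>i\<in>{1..<n}. f (x \<otimes> t i) * cnj (c i (t i))))"
    by (intro sum.cong refl)
      (simp add: autocorrelation_def sum_distrib_right prod.distrib mult.assoc)
  also have "\<dots> = (\<Sum>x\<in>carrier G. f x * (\<Sum>t\<in>?P. \<Prod>i\<in>{1..<n}. f (x \<otimes> t i) * cnj (c i (t i))))"
    by (subst sum.swap) (simp add: sum_distrib_left)
  also have "\<dots> = (\<Sum>x\<in>carrier G. f x * (\<Prod>i\<in>{1..<n}. fourier_transform G (\<lambda>y. f (x \<otimes> y)) (c i)))"
    using assms(2) by (simp add: prod_sum_PiE fourier_transform_def)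
  also have "\<dots> = (\<Sum>x\<in>carrier G. f x * (\<Prod>i\<in>{1..<n}. c i x * fourier_transform G f (c i)))"
    using assms by (intro sum.cong refl arg_cong2[of _ _ _ _ "(*)"] prod.cong)
      (auto simp: fourier_transform_shift)
  also have "\<dots> = fourier_transform G f (\<lambda>x. cnj (\<Prod>i\<in>{1..<n}. c i x)) *
      (\<Prod>i\<in>{1..<n}. fourier_transform G f (c i))"
    by (simp add: fourier_transform_def prod.distrib sum_distrib_right mult.assoc del: cnj_prod)
  finally show ?thesis .
qed

lemma fourier_transform_cong:
  "(\<And>x. x \<in> carrier G \<Longrightarrow> c x = c' x) \<Longrightarrow> fourier_transform G f c = fourier_transform G f c'"
  by (simp add: fourier_transform_def)

text \<open>A relation makes the first character the conjugate of the product of the others, so the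
  product of coefficients is a Fourier sum of the autocorrelation of order \<open>length cs\<close>.
  The empty list is trivial.\<close>

lemma prod_list_fourier_transform_eq:
  fixes G (structure)
  assumes G: "group G" "finite (carrier G)"
    and cs: "\<And>c. c \<in> set cs \<Longrightarrow> unitary_character_on G c"
    and one: "\<And>x. x \<in> carrier G \<Longrightarrow> (\<Prod>c\<leftarrow>cs. c x) = 1"
    and eq: "cs \<noteq> [] \<Longrightarrow> autocorrelation G (length cs) f = autocorrelation G (length cs) g"
  shows "(\<Prod>c\<leftarrow>cs. fourier_transform G f c) = (\<Prod>c\<leftarrow>cs. fourier_transform G g c)"
proof (cases "cs = []")
  case False
  define n where "n = length cs"
  have split: "prod_list (map F cs) = F (cs ! 0) * (\<Prod>i\<in>{1..<n}. F (cs ! i))"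
    for F :: "('a \<Rightarrow> complex) \<Rightarrow> complex"
  proof -
    have n: "{0..<n} = insert 0 {1..<n}" using False by (auto simp: n_def)
    have "prod_list (map F cs) = (\<Prod>i\<in>{0..<n}. F (cs ! i))"
      by (simp add: prod.list_conv_set_nth n_def)
    then show ?thesis unfolding n by simp
  qed
  have uc: "unitary_character_on G (cs ! i)" if "i < n" for i
    using that cs by (simp add: n_def)
  have c0: "(cs ! 0) x = cnj (\<Prod>i\<in>{1..<n}. (cs ! i) x)" if x: "x \<in> carrier G" for x
  proof -
    define p where "p = (\<Prod>i\<in>{1..<n}. (cs ! i) x)"
    have "norm p = 1"
      unfolding p_def prod_norm[symmetric] using uc x
      by (intro prod.neutral) (auto simp: unitary_character_on_def)
    then have "p * cnj p = 1" by (rule unitary_mult_cnj)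
    moreover have "(cs ! 0) x * p = 1" using one[OF x] unfolding split p_def .
    ultimately show ?thesis unfolding p_def[symmetric]
      by (metis mult.assoc mult.commute mult_1)
  qed
  have "(\<Prod>c\<leftarrow>cs. fourier_transform G f c) =
     (\<Sum>t\<in>(\<Pi>\<^sub>E i\<in>{1..<n}. carrier G). autocorrelation G n f t * (\<Prod>i\<in>{1..<n}. cnj ((cs ! i) (t i))))" for f
    unfolding split using fourier_transform_cong[of G "cs ! 0", OF c0] uc
    by (subst fourier_transform_autocorrelation[OF G]) auto
  then show ?thesis using eq[OF False] by (simp add: n_def)
qed simp

text \<open>The first sum is evaluated at \<open>w = root_char N (- u)\<close>. With
  \<open>v\<close> an inverse of \<open>u\<close> modulo \<open>N\<close>, the conjugate
  \<open>w ^ v\<close> is \<open>root_char N (- 1)\<close>, which gives the second sum.\<close>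

lemma root_char_vanishing_conjugate:
  fixes a :: "'i \<Rightarrow> complex" and e :: "'i \<Rightarrow> int"
  assumes N: "N > 0" and X: "finite X" and u: "coprime u (int N)"
    and a: "\<And>i. i \<in> X \<Longrightarrow> a i \<in> \<rat>"
    and 0: "(\<Sum>i\<in>X. a i * cnj (root_char N (u * e i))) = 0"
  shows "(\<Sum>i\<in>X. a i * cnj (root_char N (e i))) = 0"
proof -
  define w where "w = root_char N (- u)"
  obtain v0 where v0: "[u * v0 = 1] (mod int N)"
    using cong_solve_coprime_int[OF u] by blast
  define v where "v = nat (v0 mod int N)"
  have "int v = v0 mod int N" using N by (simp add: v_def)
  then have "[u * int v = u * v0] (mod int N)" by (intro cong_scalar_left) (simp add: cong_def)
  then have uv: "[u * int v = 1] (mod int N)" using v0 by (rule cong_trans)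
  then have "coprime (u * int v) (int N)"
    by (metis cong_imp_coprime cong_sym coprime_1_left)
  then have cv: "coprime v N" by simp
  define d where "d i = nat (e i mod int N)" for i
  have d: "[int (d i) = e i] (mod int N)" for i using N by (simp add: d_def)
  have w: "w ^ N = 1"
    using N by (simp add: w_def root_char_mult_nat[symmetric] root_char_eq_1_iff)
  have w_d: "w ^ d i = cnj (root_char N (u * e i))" for i
    unfolding w_def root_char_mult_nat[symmetric] root_char_minus[symmetric]
    using N cong_scalar_left[OF d, of "- u" i] by (intro root_char_cong) simp_all
  have wv: "w ^ v = root_char N (- 1)"
    unfolding w_def root_char_mult_nat[symmetric]
    using N cong_scalar_left[OF uv, of "- 1"] by (intro root_char_cong) simp_all
  have wv_d: "(w ^ v) ^ d i = cnj (root_char N (e i))" for i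
    unfolding wv root_char_mult_nat[symmetric] root_char_minus[symmetric]
    using N cong_scalar_left[OF d, of "- 1" i] by (intro root_char_cong) simp_all
  have "(\<Sum>i\<in>X. a i * (w ^ v) ^ d i) = 0"
    using 0 by (intro vanishing_rat_sum_conjugate[OF w N X cv a]) (simp_all only: w_d)
  then show ?thesis by (simp only: wv_d)
qed

section \<open>Finite abelian groups with cyclic coordinates\<close>

text \<open>Characters are indexed by arbitrary integer vectors \<open>m\<close>, not by residues modulo \<open>N i\<close>, so
  that they form the ordinary additive group of functions \<open>I \<Rightarrow> \<int>\<close>.\<close>

locale coordinatised_group = comm_group G
  for G :: "('a, 'b) monoid_scheme" (structure) +
  fixes I :: "'i set" and N :: "'i \<Rightarrow> nat" and \<phi> :: "'a \<Rightarrow> 'i \<Rightarrow> int"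
  assumes finite_carrier: "finite (carrier G)" and finite_I: "finite I"
    and N_pos: "i \<in> I \<Longrightarrow> N i > 0"
    and iso: "\<phi> \<in> iso G (sum_group I (\<lambda>i. integer_mod_group (N i)))"
begin

definition chr :: "('i \<Rightarrow> int) \<Rightarrow> 'a \<Rightarrow> complex" where
  "chr m x = pairing I N m (\<phi> x)"

lemma carrier_coords:
  "carrier (sum_group I (\<lambda>i. integer_mod_group (N i))) = (\<Pi>\<^sub>E i\<in>I. {0..<int (N i)})"
proof -
  have "carrier (sum_group I (\<lambda>i. integer_mod_group (N i))) =
      (\<Pi>\<^sub>E i\<in>I. carrier (integer_mod_group (N i)))"
    using finite_I by (simp add: carrier_sum_group)
  also have "\<dots> = (\<Pi>\<^sub>E i\<in>I. {0..<int (N i)})"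
    using N_pos by (intro PiE_cong) (simp add: carrier_integer_mod_group)
  finally show ?thesis .
qed

lemma bij_coords: "bij_betw \<phi> (carrier G) (\<Pi>\<^sub>E i\<in>I. {0..<int (N i)})"
  using iso unfolding iso_def carrier_coords by simp

lemma coords_mult:
  assumes "x \<in> carrier G" "y \<in> carrier G" "i \<in> I"
  shows "[\<phi> (x \<otimes> y) i = \<phi> x i + \<phi> y i] (mod int (N i))"
proof -
  have "\<phi> (x \<otimes> y) = \<phi> x \<otimes>\<^bsub>sum_group I (\<lambda>i. integer_mod_group (N i))\<^esub> \<phi> y"
    using iso assms by (intro hom_mult) (auto simp: iso_def)
  then show ?thesis using assms(3) by (simp add: cong_def)
qed

lemma coords_eqI:
  assumes "x \<in> carrier G" "y \<in> carrier G" "\<And>i. i \<in> I \<Longrightarrow> int (N i) dvd \<phi> x i - \<phi> y i"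
  shows "x = y"
proof -
  have xy: "\<phi> x \<in> (\<Pi>\<^sub>E i\<in>I. {0..<int (N i)})" "\<phi> y \<in> (\<Pi>\<^sub>E i\<in>I. {0..<int (N i)})"
    using bij_coords assms(1,2) by (auto simp: bij_betw_def)
  have "\<phi> x i = \<phi> y i" if "i \<in> I" for i
  proof -
    have "[\<phi> x i = \<phi> y i] (mod int (N i))" using assms(3)[OF that] by (simp add: cong_iff_dvd_diff)
    moreover have "\<phi> x i mod int (N i) = \<phi> x i" "\<phi> y i mod int (N i) = \<phi> y i"
      using xy that by (auto dest!: PiE_mem)
    ultimately show ?thesis by (simp add: cong_def)
  qed
  then have "\<phi> x = \<phi> y" using xy by (intro PiE_ext)
  then show ?thesis using bij_coords assms(1,2) by (auto simp: bij_betw_def inj_on_def)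
qed

lemma unitary_character_chr: "unitary_character_on G (chr m)"
  unfolding unitary_character_on_def chr_def
proof (intro conjI ballI)
  fix x y assume "x \<in> carrier G" "y \<in> carrier G"
  then show "pairing I N m (\<phi> (x \<otimes> y)) = pairing I N m (\<phi> x) * pairing I N m (\<phi> y)"
    unfolding pairing_add_right[symmetric] using N_pos coords_mult
    by (intro pairing_cong_right) auto
qed simp

lemma chr_single:
  "i \<in> I \<Longrightarrow> chr (\<lambda>j. if j = i then u else 0) x = root_char (N i) (u * \<phi> x i)"
  unfolding chr_def using finite_I by (rule pairing_single_left)

text \<open>Fourier inversion: by orthogonality, summing the coefficients times
  \<open>chr m x\<close> over all residue vectors \<open>m\<close> gives \<open>f x\<close> times
  the number of these vectors.\<close>

lemma fourier_transform_eq_0D: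
  assumes "\<And>m. fourier_transform G f (chr m) = 0" "x \<in> carrier G"
  shows "f x = 0"
proof -
  let ?M = "\<Pi>\<^sub>E j\<in>I. {..<N j}"
  have orth: "(\<Sum>m\<in>?M. pairing I N (\<lambda>j. int (m j)) (\<phi> x - \<phi> y)) = (if y = x then of_nat (card ?M) else 0)"
    if y: "y \<in> carrier G" for y
  proof (cases "y = x")
    case True
    then show ?thesis by (simp add: pairing_def)
  next
    case False
    then obtain i where "i \<in> I" "\<not> int (N i) dvd \<phi> x i - \<phi> y i"
      using coords_eqI[OF assms(2) y] by auto
    then show ?thesis using False sum_pairing_eq_0[OF finite_I N_pos, where i = i and y = "\<phi> x - \<phi> y"]
      by simp
  qed
  have "(\<Sum>m\<in>?M. fourier_transform G f (chr (\<lambda>j. int (m j))) * chr (\<lambda>j. int (m j)) x) =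
      (\<Sum>m\<in>?M. \<Sum>y\<in>carrier G. f y * pairing I N (\<lambda>j. int (m j)) (\<phi> x - \<phi> y))"
    unfolding fourier_transform_def chr_def sum_distrib_right
  proof (intro sum.cong refl)
    fix m :: "'i \<Rightarrow> nat" and y
    have "pairing I N (\<lambda>j. int (m j)) (\<phi> x - \<phi> y) =
        cnj (pairing I N (\<lambda>j. int (m j)) (\<phi> y)) * pairing I N (\<lambda>j. int (m j)) (\<phi> x)"
      unfolding pairing_minus_left[symmetric] unfolding pairing_def prod.distrib[symmetric]
      by (intro prod.cong refl) (simp add: algebra_simps flip: root_char_add)
    then show "f y * cnj (pairing I N (\<lambda>j. int (m j)) (\<phi> y)) * pairing I N (\<lambda>j. int (m j)) (\<phi> x) =
        f y * pairing I N (\<lambda>j. int (m j)) (\<phi> x - \<phi> y)"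
      by (simp only: mult.assoc)
  qed
  also have "\<dots> = (\<Sum>y\<in>carrier G. f y * (\<Sum>m\<in>?M. pairing I N (\<lambda>j. int (m j)) (\<phi> x - \<phi> y)))"
    by (subst sum.swap) (simp only: sum_distrib_left)
  also have "\<dots> = (\<Sum>y\<in>carrier G. if y = x then f y * of_nat (card ?M) else 0)"
    by (intro sum.cong refl) (simp only: orth if_distrib[of "(*) _"] mult_zero_right)
  also have "\<dots> = f x * of_nat (card ?M)"
    using finite_carrier assms(2) by simp
  finally have "f x * of_nat (card ?M) = 0" using assms(1) by simp
  moreover have "card ?M > 0" using finite_I N_pos by (simp add: card_PiE prod_pos)
  ultimately show ?thesis by simp
qed

lemma fourier_transform_eqD:
  assumes "\<And>m. fourier_transform G f (chr m) = fourier_transform G g (chr m)" "x \<in> carrier G"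
  shows "f x = g x"
proof -
  have "f x - g x = 0"
  proof (rule fourier_transform_eq_0D[of "\<lambda>x. f x - g x"])
    show "fourier_transform G (\<lambda>x. f x - g x) (chr m) = 0" for m
      using assms(1)[of m] by (simp add: fourier_transform_def left_diff_distrib sum_subtractf)
  qed fact
  then show ?thesis by simp
qed

text \<open>As \<open>f\<close> is rational, a zero at the power \<open>u\<close> of the character
  would be carried by Galois conjugation to a zero at the character itself.\<close>

lemma fourier_transform_single_neq_0:
  assumes f: "f \<in> carrier G \<rightarrow> \<rat>" and i: "i \<in> I" and u: "coprime u (int (N i))"
    and nz: "fourier_transform G f (chr (\<lambda>j. if j = i then 1 else 0)) \<noteq> 0"
  shows "fourier_transform G f (chr (\<lambda>j. if j = i then u else 0)) \<noteq> 0"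
proof
  assume "fourier_transform G f (chr (\<lambda>j. if j = i then u else 0)) = 0"
  then have "(\<Sum>x\<in>carrier G. f x * cnj (root_char (N i) (u * \<phi> x i))) = 0"
    unfolding fourier_transform_def chr_single[OF i] .
  then have "(\<Sum>x\<in>carrier G. f x * cnj (root_char (N i) (\<phi> x i))) = 0"
    by (rule root_char_vanishing_conjugate[OF N_pos[OF i] finite_carrier u funcset_mem[OF f], rotated])
  then show False using nz by (simp add: fourier_transform_def chr_single[OF i])
qed

text \<open>Each coordinate is split into units separately and the lists are concatenated, so the
  bounds add up. Only coordinates in \<open>I\<close> are prescribed, because the others do not
  affect the character.\<close>

lemma ex_short_coprime_list:
  assumes "\<And>i. i \<in> I \<Longrightarrow> N i > 1"
    and T: "\<And>i u. i \<in> I \<Longrightarrow> coprime u (int (N i)) \<Longrightarrow> (\<lambda>j. if j = i then u else 0) \<in> T"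
  shows "\<exists>L. set L \<subseteq> T \<and>
    length L \<le> (\<Sum>i\<in>I. if odd (N i) \<or> (\<exists>m. N i = 2 ^ m) then 2 else 3) \<and>
    (\<forall>i\<in>I. sum_list L i = v i)"
proof -
  let ?b = "\<lambda>i. if odd (N i) \<or> (\<exists>m. N i = 2 ^ m) then 2 else 3 :: nat"
  have "\<exists>L. set L \<subseteq> T \<and> length L \<le> (\<Sum>i\<in>J. ?b i) \<and> sum_list L = (\<lambda>i. if i \<in> J then v i else 0)"
    if "finite J" "J \<subseteq> I" for J
    using that
  proof (induction J)
    case empty
    show ?case by (intro exI[of _ "[]"]) (auto simp: fun_eq_iff)
  next
    case (insert i J)
    then obtain L where L: "set L \<subseteq> T" "length L \<le> (\<Sum>i\<in>J. ?b i)"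
        "sum_list L = (\<lambda>i. if i \<in> J then v i else 0)" by auto
    obtain U where U: "\<And>u. u \<in> set U \<Longrightarrow> coprime u (int (N i))" "sum_list U = v i" "length U \<le> ?b i"
      using int_eq_sum_list_coprime[OF assms(1), of i "v i"] insert.prems by auto
    let ?e = "\<lambda>u j. if j = i then u else 0 :: int"
    have e: "sum_list (map ?e U) = ?e (sum_list U)" for U
      by (induction U) (auto simp: fun_eq_iff)
    show ?case
    proof (intro exI[of _ "map ?e U @ L"] conjI)
      show "set (map ?e U @ L) \<subseteq> T" using L(1) U(1) T insert.prems by auto
      show "length (map ?e U @ L) \<le> (\<Sum>i\<in>insert i J. ?b i)"
        using L(2) U(3) insert.hyps by simp
      show "sum_list (map ?e U @ L) = (\<lambda>j. if j \<in> insert i J then v j else 0)"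
        using insert.hyps(2) by (auto simp: e U(2) L(3) fun_eq_iff)
    qed
  qed
  from this[OF finite_I order_refl] obtain L where
    "set L \<subseteq> T" "length L \<le> (\<Sum>i\<in>I. ?b i)" "sum_list L = (\<lambda>i. if i \<in> I then v i else 0)" by auto
  then show ?thesis by (intro exI[of _ L]) simp
qed

text \<open>The ratio \<open>F / E\<close> has product 1 along all relations of length at most
  \<open>3 * s\<close> in the support. It therefore extends to a homomorphism, which duality turns
  into evaluation at the required shift.\<close>

lemma autocorrelations_determine_up_to_shift:
  assumes f: "f \<in> carrier G \<rightarrow> \<rat>" and g: "g \<in> carrier G \<rightarrow> \<rat>"
    and s: "s > 0"
    and eq: "\<And>n. n \<in> {1..3 * s} \<Longrightarrow> autocorrelation G n f = autocorrelation G n g"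
    and gen: "\<And>v. \<exists>L. set L \<subseteq> {m. fourier_transform G f (chr m) \<noteq> 0} \<and> length L \<le> s \<and>
      (\<forall>i\<in>I. sum_list L i = v i)"
  shows "\<exists>a\<in>carrier G. \<forall>x\<in>carrier G. f x = g (x \<otimes> a)"
proof -
  define F where "F m = fourier_transform G f (chr m)" for m
  define E where "E m = fourier_transform G g (chr m)" for m
  define T where "T = {m. F m \<noteq> 0}"
  \<comment> \<open>Index vectors of the trivial character; a list with sum in \<open>K\<close> is a
    relation among characters.\<close>
  define K where "K = {m. \<forall>x\<in>carrier G. chr m x = 1}"
  have chr_sum_list: "chr (sum_list L) x = (\<Prod>m\<leftarrow>L. chr m x)" for L x
    unfolding chr_def by (rule pairing_sum_list_left)
  have prods: "(\<Prod>m\<leftarrow>L. F m) = (\<Prod>m\<leftarrow>L. E m)" if "length L \<le> 3 * s" "sum_list L \<in> K" for L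
  proof -
    have "(\<Prod>c\<leftarrow>map chr L. fourier_transform G f c) = (\<Prod>c\<leftarrow>map chr L. fourier_transform G g c)"
    proof (rule prod_list_fourier_transform_eq)
      show "(\<Prod>c\<leftarrow>map chr L. c x) = 1" if "x \<in> carrier G" for x
        using that \<open>sum_list L \<in> K\<close> by (simp add: K_def chr_sum_list comp_def)
      show "autocorrelation G (length (map chr L)) f = autocorrelation G (length (map chr L)) g"
        if "map chr L \<noteq> []"
        using that \<open>length L \<le> 3 * s\<close> eq[of "length L"] by (cases L) auto
    qed (use unitary_character_chr finite_carrier in \<open>auto intro: is_group\<close>)
    then show ?thesis by (simp add: F_def E_def comp_def)
  qed
  have conj: "fourier_transform G q (chr (- m)) = cnj (fourier_transform G q (chr m))"
    if "q \<in> carrier G \<rightarrow> \<rat>" for q m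
  proof -
    have "cnj (q x) = q x" if "x \<in> carrier G" for x
      using that \<open>q \<in> carrier G \<rightarrow> \<rat>\<close> by (auto elim!: Rats_cases' dest!: funcset_mem)
    then show ?thesis by (simp add: fourier_transform_def chr_def pairing_minus_left)
  qed
  have K0: "0 \<in> K" by (simp add: K_def chr_def)
  \<comment> \<open>The relation \<open>[m, - m]\<close> of order 2 shows that \<open>F m\<close>
    and \<open>E m\<close> have the same absolute value, as \<open>f\<close> and \<open>g\<close>
    are real on the group.\<close>
  have E0: "E m = 0 \<longleftrightarrow> F m = 0" for m
  proof -
    have "(\<Prod>m\<leftarrow>[m, - m]. F m) = (\<Prod>m\<leftarrow>[m, - m]. E m)"
      using s K0 by (intro prods) auto
    then have "F m * cnj (F m) = E m * cnj (E m)"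
      using conj[OF f] conj[OF g] by (simp add: F_def E_def)
    then show ?thesis by (metis complex_cnj_zero_iff mult_eq_0_iff)
  qed
  have "\<exists>H. (\<forall>v w. H (v + w) = H v * H w) \<and> (\<forall>t\<in>T. H t = F t / E t) \<and> (\<forall>v\<in>K. H v = 1)"
  proof (rule multiplicative_extension[where s = s])
    show "v - w \<in> K" if "v \<in> K" "w \<in> K" for v w
    proof -
      have "chr (v + (- w)) x = chr v x * cnj (chr w x)" for x
        unfolding chr_def pairing_add_left pairing_minus_left ..
      then show ?thesis using that by (simp add: K_def)
    qed
    show "- t \<in> T" if "t \<in> T" for t
      using that conj[OF f] by (simp add: T_def F_def)
    show "prod_list (map (\<lambda>t. F t / E t) L) = 1"
      if "set L \<subseteq> T" "length L \<le> 3 * s" "sum_list L \<in> K" for L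
    proof -
      have "prod_list (map (\<lambda>t. F t / E t) L) * (\<Prod>m\<leftarrow>L. E m) = (\<Prod>m\<leftarrow>L. F m)"
        using that(1) by (induction L) (auto simp: T_def E0 mult_ac)
      moreover have "(\<Prod>m\<leftarrow>L. E m) \<noteq> 0" using that(1) by (induction L) (auto simp: T_def E0)
      ultimately show ?thesis using prods[OF that(2,3)] by simp
    qed
    show "\<exists>L. set L \<subseteq> T \<and> length L \<le> s \<and> v - sum_list L \<in> K" for v
    proof -
      obtain L where L: "set L \<subseteq> T" "length L \<le> s" "\<And>i. i \<in> I \<Longrightarrow> sum_list L i = v i"
        using gen[of v] by (auto simp: T_def F_def)
      \<comment> \<open>The difference vanishes on \<open>I\<close> but perhaps not elsewhere, so it
        is only known to lie in \<open>K\<close>.\<close>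
      have "chr (v - sum_list L) x = 1" for x
        unfolding chr_def pairing_def using L(3) by (intro prod.neutral) simp
      then show ?thesis using L by (auto simp: K_def)
    qed
  qed (use s K0 in auto)
  then obtain H where H_add: "\<And>v w. H (v + w) = H v * H w"
    and H_T: "\<And>t. t \<in> T \<Longrightarrow> H t = F t / E t" and H_K: "\<And>v. v \<in> K \<Longrightarrow> H v = 1"
    by blast
  have "H v = 1" if "\<And>i. i \<in> I \<Longrightarrow> int (N i) dvd v i" for v
  proof (rule H_K)
    have "chr v x = 1" for x
      unfolding chr_def pairing_def using that N_pos
      by (intro prod.neutral) (auto simp: root_char_eq_1_iff)
    then show "v \<in> K" by (simp add: K_def)
  qed
  then obtain b where b: "b \<in> (\<Pi>\<^sub>E i\<in>I. {0..<int (N i)})" "\<And>v. H v = pairing I N v b"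
    using multiplicative_eq_pairing[of I N H, OF finite_I N_pos H_add] by blast
  obtain a where a: "a \<in> carrier G" "\<phi> a = b"
    using b(1) bij_coords unfolding bij_betw_def by (metis imageE)
  \<comment> \<open>Off the support both sides are 0, so the ratio is needed on \<open>T\<close>
    alone.\<close>
  have "F m = chr m a * E m" for m
  proof (cases "m \<in> T")
    case True
    then have "F m / E m = chr m a" using H_T b(2) a(2) by (simp add: chr_def)
    moreover have "E m \<noteq> 0" using True E0 by (simp add: T_def)
    ultimately show ?thesis by (metis nonzero_divide_eq_eq)
  next
    case False
    then show ?thesis using E0 by (simp add: T_def)
  qed
  then have "fourier_transform G f (chr m) = fourier_transform G (\<lambda>x. g (a \<otimes> x)) (chr m)" for m
    unfolding F_def E_def fourier_transform_shift[OF is_group unitary_character_chr a(1), of g m] .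
  then have "f x = g (a \<otimes> x)" if "x \<in> carrier G" for x
    using that by (rule fourier_transform_eqD)
  then show ?thesis using a(1) by (intro bexI[of _ a]) (auto simp: m_comm)
qed

end

section \<open>The basic characters and the bound 3r - k\<close>

theorem theorem4p2:
  fixes G :: "('a, 'b) monoid_scheme" (structure)
    and r k :: nat
    and N :: "nat \<Rightarrow> nat"
    and \<phi> :: "'a \<Rightarrow> nat \<Rightarrow> int"
    and f g :: "'a \<Rightarrow> complex"
  assumes "comm_group G" and "finite (carrier G)"
    and "r \<ge> 1"
    and "\<And>i. i \<in> {1..r} \<Longrightarrow> N i > 1"
    and "\<And>i. i \<in> {1..<r} \<Longrightarrow> N i dvd N (Suc i)"
    and "\<phi> \<in> iso G (sum_group {1..r} (\<lambda>i. integer_mod_group (N i)))"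
    and "k = card {i \<in> {1..r}. odd (N i) \<or> (\<exists>m. N i = 2 ^ m)}"
    and "f \<in> carrier G \<rightarrow> \<rat>"
    and "\<And>i. i \<in> {1..r} \<Longrightarrow> basic_character G \<phi> r N i \<in> fourier_support G f"
    and "g \<in> carrier G \<rightarrow> \<rat>"
    and "\<And>n. n \<in> {1..3 * (3 * r - k)} \<Longrightarrow> autocorrelation G n f = autocorrelation G n g"
  shows "\<exists>a\<in>carrier G. \<forall>x\<in>carrier G. f x = g (x \<otimes> a)"
proof -
  interpret coordinatised_group G "{1..r}" N \<phi>
  proof (intro coordinatised_group.intro coordinatised_group_axioms.intro)
    show "0 < N i" if "i \<in> {1..r}" for i using assms(4)[OF that] by simp
  qed (use assms(1,2,6) in auto)
  let ?P = "\<lambda>i. odd (N i) \<or> (\<exists>m. N i = 2 ^ m)"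
  have k_sum: "k = (\<Sum>i=1..r. if ?P i then 1 else 0)"
    unfolding assms(7) card_eq_sum by (rule sum.inter_filter) simp
  have "k \<le> (\<Sum>i=1..r. 1)" unfolding k_sum by (intro sum_mono) simp
  then have k: "k \<le> r" by simp
  \<comment> \<open>Each index counted by \<open>k\<close> contributes 2 + 1 and every other one 3 +
    0.\<close>
  have "(\<Sum>i=1..r. if ?P i then 2 else 3) + k = (\<Sum>i=1..r. 3)"
    unfolding k_sum sum.distrib[symmetric] by (intro sum.cong refl) (simp only: split: if_split, simp)
  then have sum: "(\<Sum>i=1..r. if ?P i then 2 else 3) = 3 * r - k" by simp
  have nz: "fourier_transform G f (chr (\<lambda>j. if j = i then 1 else 0)) \<noteq> 0" if i: "i \<in> {1..r}" for i
  proof -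
    \<comment> \<open>\<open>basic_character\<close> is extensional and \<open>chr\<close> is not,
      so they are compared on the carrier, which is all the Fourier transform sees.\<close>
    have "basic_character G \<phi> r N i x = chr (\<lambda>j. if j = i then 1 else 0) x" if x: "x \<in> carrier G" for x
    proof -
      have coord: "\<phi> x j \<in> carrier (integer_mod_group (N j))" if "j \<in> {1..r}" for j
      proof -
        have "\<phi> x \<in> (\<Pi>\<^sub>E i\<in>{1..r}. {0..<int (N i)})"
          using bij_coords x by (rule bij_betwE[THEN bspec])
        then have "\<phi> x j \<in> {0..<int (N j)}" using that by (rule PiE_mem)
        then show ?thesis by (auto simp: carrier_integer_mod_group)
      qed
      have "basic_character G \<phi> r N i x = (\<Prod>j\<in>{1..r}. (if j = i then e1 (N j)
          else \<one>\<^bsub>dual_group (integer_mod_group (N j))\<^esub>) (\<phi> x j))"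
        unfolding basic_character_def character_of_tuple_def using x by simp
      also have "\<dots> = (\<Prod>j\<in>{1..r}. if j = i then root_char (N i) (\<phi> x i) else 1)"
      proof (intro prod.cong refl)
        fix j assume "j \<in> {1..r}"
        then show "(if j = i then e1 (N j) else \<one>\<^bsub>dual_group (integer_mod_group (N j))\<^esub>) (\<phi> x j) =
            (if j = i then root_char (N i) (\<phi> x i) else 1)"
          using coord[of j] by (cases "j = i") (simp_all add: e1_def dual_group_def root_char_def cis_conv_exp mult_ac)
      qed
      also have "\<dots> = chr (\<lambda>j. if j = i then 1 else 0) x"
        unfolding chr_single[OF i] using i by simp
      finally show ?thesis .
    qed
    then have "fourier_transform G f (chr (\<lambda>j. if j = i then 1 else 0)) =
        fourier_transform G f (basic_character G \<phi> r N i)"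
      by (intro fourier_transform_cong) simp
    then show ?thesis using assms(9)[OF i] by (simp add: fourier_support_def)
  qed
  show ?thesis
  proof (rule autocorrelations_determine_up_to_shift[OF assms(8,10) _ assms(11)])
    show "3 * r - k > 0" using k assms(3) by simp
    show "\<exists>L. set L \<subseteq> {m. fourier_transform G f (chr m) \<noteq> 0} \<and> length L \<le> 3 * r - k \<and>
        (\<forall>i\<in>{1..r}. sum_list L i = v i)" for v
      unfolding sum[symmetric]
    proof (rule ex_short_coprime_list[OF assms(4)])
      fix i u assume i: "i \<in> {1..r}" and "coprime u (int (N i))"
      then show "(\<lambda>j. if j = i then u else 0) \<in> {m. fourier_transform G f (chr m) \<noteq> 0}"
        using fourier_transform_single_neq_0[OF assms(8) i _ nz[OF i], of u] by (intro CollectI)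
    qed
  qed
qed

end
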